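(* Let $n_1,\ldots,n_m$ be positive integers and set $n_{m+1}=0$. Then $$n_1!\prod_{i=1}^m\frac{(n_i+n_{i+1})!}{(2n_i)!}\sum_{k=-n_1}^{n_1}(-1)^k\prod_{i=1}^m\binom{2n_i}{n_i+k}\in\mathbb{N}.$$
   Context: Binomial coefficients $\binom{a}{b}$ are $0$ when $b<0$ or $b>a$; $\mathbb{N}=\{0,1,2,\ldots\}$. *)

theory Defs
  imports Complex_Main
begin

text \<open>
  Binomial coefficients with an integer lower index.  A guard is needed because
  the library operation takes a natural lower index and \<open>nat b = 0\<close> for negative \<open>b\<close>.
\<close>

definition binom :: "nat \<Rightarrow> int \<Rightarrow> nat" where
  "binom a b = (if b < 0 then 0 else a choose nat b)"

end

theory Submission
  imports Defs
begin

text \<open>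
  Put \<open>w n k = 1 / ((n + k)! (n - k)!)\<close>.  Vandermonde's convolution expands
  \<open>(a + b)! w a k w b k\<close> as a combination of the \<open>w s k\<close> with coefficients
  \<open>1 / ((a - s)! (b - s)!)\<close>.  Writing \<open>S(n\<^sub>1, \<dots>, n\<^sub>m)\<close> for the quantity of the theorem,
  this merges its first two arguments:
  \<open>S(n\<^sub>1, \<dots>, n\<^sub>m) = (\<Sum>s. (n\<^sub>1 choose s) (n\<^sub>2 + n\<^sub>3 choose n\<^sub>2 - s) S(s, n\<^sub>3, \<dots>, n\<^sub>m))\<close>.
  Induction on \<open>m\<close> ends at \<open>S(n\<^sub>1)\<close>, which is \<open>1\<close> if \<open>n\<^sub>1 = 0\<close> and \<open>0\<close> otherwise.
\<close>

text \<open>The value 0 outside \<open>\<bar>k\<bar> \<le> n\<close> matches the vanishing of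
  binomial coefficients and lets summation ranges over \<open>k\<close> and \<open>s\<close> be
  adjusted freely.\<close>

definition w :: "nat \<Rightarrow> int \<Rightarrow> real" where
  "w n k = (if \<bar>k\<bar> \<le> int n then 1 / (fact (nat (int n + k)) * fact (nat (int n - k))) else 0)"

lemma w_minus: "w n (- k) = w n k"
  by (simp add: w_def mult.commute)

lemma w_of_nat: "j \<le> n \<Longrightarrow> w n (int j) = 1 / (fact (n + j) * fact (n - j))"
  by (simp add: w_def nat_diff_distrib flip: of_nat_add of_nat_diff)

lemma w_eq_0: "\<bar>k\<bar> > int n \<Longrightarrow> w n k = 0"
  by (simp add: w_def)

text \<open>The factor \<open>fact (2 * n)\<close> does not depend on \<open>k\<close>, so it can
  leave the sum over \<open>k\<close> and cancel the denominators of the theorem.\<close>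

lemma binom_central: "real (binom (2 * n) (int n + k)) = fact (2 * n) * w n k"
proof (cases "\<bar>k\<bar> \<le> int n")
  case True
  then have le: "nat (int n + k) \<le> 2 * n" and "2 * n - nat (int n + k) = nat (int n - k)"
    by linarith+
  then show ?thesis
    using True binomial_fact[OF le, where 'a = real] by (simp add: binom_def w_def)
next
  case False
  then have "int n + k < 0 \<or> nat (int n + k) > 2 * n"
    by linarith
  with False show ?thesis
    by (auto simp: binom_def w_def)
qed

lemma w_mult_of_nat:
  "fact (a + b) * w a (int j) * w b (int j) =
     (\<Sum>s\<le>min a b. w s (int j) / (fact (a - s) * fact (b - s)))"
proof (cases "j \<le> a \<and> j \<le> b")
  case True
  \<comment> \<open>\<open>p\<close> is the common denominator that turns every summand, reindexed
    by \<open>s = t + j\<close>, into a Vandermonde product.\<close>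
  define p where "p = fact (a - j) * (fact (b + j) :: real)"
  have p: "p \<noteq> 0"
    by (simp add: p_def)
  have summand: "w (t + j) (int j) / (fact (a - (t + j)) * fact (b - (t + j))) =
      real ((a - j choose t) * (b + j choose (b - j - t))) / p" if "t \<le> min a b - j" for t
  proof -
    have "real (a - j choose t) = fact (a - j) / (fact t * fact (a - (t + j)))"
      using that True by (subst binomial_fact) (auto simp: add.commute)
    moreover have "b + j - (b - j - t) = t + j + j"
      using that True by linarith
    then have "real (b + j choose (b - j - t)) =
        fact (b + j) / (fact (b - (t + j)) * fact (t + j + j))"
      using that True by (subst binomial_fact) (auto simp: add.commute)
    moreover have "w (t + j) (int j) = 1 / (fact (t + j + j) * fact t)"
      using w_of_nat[of j "t + j"] by simp
    ultimately show ?thesis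
      by (simp add: p_def)
  qed
  have "(\<Sum>s\<le>min a b. w s (int j) / (fact (a - s) * fact (b - s))) =
      (\<Sum>s=j..min a b. w s (int j) / (fact (a - s) * fact (b - s)))"
    by (rule sum.mono_neutral_right) (auto simp: w_eq_0)
  also have "\<dots> = (\<Sum>t\<le>min a b - j. w (t + j) (int j) / (fact (a - (t + j)) * fact (b - (t + j))))"
    by (rule sum.reindex_bij_witness[of _ "\<lambda>t. t + j" "\<lambda>s. s - j"]) (use True in auto)
  also have "\<dots> = (\<Sum>t\<le>min a b - j. real ((a - j choose t) * (b + j choose (b - j - t))) / p)"
    by (rule sum.cong) (use summand in auto)
  \<comment> \<open>The added terms have \<open>t > a - j\<close>, so \<open>a - j choose t\<close>
    vanishes.\<close>
  also have "\<dots> = (\<Sum>t\<le>b - j. real ((a - j choose t) * (b + j choose (b - j - t))) / p)"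
    by (rule sum.mono_neutral_left) auto
  also have "\<dots> = real (\<Sum>t\<le>b - j. (a - j choose t) * (b + j choose (b - j - t))) / p"
    by (simp add: sum_divide_distrib)
  also have "\<dots> = real (a + b choose (b - j)) / p"
    using True by (subst vandermonde) simp
  also have "\<dots> = fact (a + b) * w a (int j) * w b (int j)"
  proof -
    have "a + b - (b - j) = a + j"
      using True by linarith
    then have "real (a + b choose (b - j)) = fact (a + b) / (fact (b - j) * fact (a + j))"
      using True by (subst binomial_fact) auto
    then show ?thesis
      using True by (simp add: p_def w_of_nat mult_ac)
  qed
  finally show ?thesis ..
next
  case False
  then have "w s (int j) = 0" if "s \<le> min a b" for s
    using that by (intro w_eq_0) auto
  moreover have "w a (int j) = 0 \<or> w b (int j) = 0"
    using False by (auto intro!: w_eq_0)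
  ultimately show ?thesis
    by auto
qed

text \<open>Both sides are even in \<open>k\<close>, which reduces the claim to
  \<open>k \<ge> 0\<close>.\<close>

lemma w_mult:
  "fact (a + b) * w a k * w b k = (\<Sum>s\<le>min a b. w s k / (fact (a - s) * fact (b - s)))"
proof (cases k rule: int_cases2)
  case (nonneg j)
  then show ?thesis by (simp only: w_mult_of_nat)
next
  case (nonpos j)
  then show ?thesis by (simp only: w_minus w_mult_of_nat)
qed

text \<open>Up to the factor \<open>(-1) ^ n / fact (2 * n)\<close>, this is the alternating sum of
  row \<open>2 * n\<close> of Pascal's triangle, shifted by \<open>n\<close>; it vanishes for
  \<open>n > 0\<close>.\<close>

lemma alternating_sum_w:
  "(\<Sum>k = - int n..int n. (-1) powi k * w n k) = (if n = 0 then 1 else 0)"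
proof (cases "n = 0")
  case False
  have "(-1) powi k * w n k =
      (-1) ^ n / fact (2 * n) * ((-1) ^ nat (k + int n) * real (2 * n choose nat (k + int n)))"
    if "k \<in> {- int n..int n}" for k
  proof -
    have "(-1 :: real) powi (k + int n) = (-1) powi k * (-1) ^ n"
      by (simp add: power_int_add)
    moreover have "(-1 :: real) powi (k + int n) = (-1) ^ nat (k + int n)"
      using that by (simp add: power_int_def)
    moreover have "real (2 * n choose nat (k + int n)) = fact (2 * n) * w n k"
      using that binom_central[of n k] by (simp add: binom_def add.commute)
    moreover have "(-1 :: real) ^ n * (-1) ^ n = 1"
      by (simp flip: power_mult_distrib)
    ultimately show ?thesis
      by (simp add: mult_ac)
  qed
  then have "(\<Sum>k = - int n..int n. (-1) powi k * w n k) =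
      (\<Sum>k = - int n..int n. (-1) ^ n / fact (2 * n) *
         ((-1) ^ nat (k + int n) * real (2 * n choose nat (k + int n))))"
    by (intro sum.cong refl)
  also have "\<dots> = (-1) ^ n / fact (2 * n) *
      (\<Sum>k = - int n..int n. (-1) ^ nat (k + int n) * real (2 * n choose nat (k + int n)))"
    by (simp only: sum_distrib_left)
  also have "(\<Sum>k = - int n..int n. (-1) ^ nat (k + int n) * real (2 * n choose nat (k + int n))) =
      (\<Sum>i\<le>2 * n. (-1) ^ i * real (2 * n choose i))"
    by (rule sum.reindex_bij_witness[of _ "\<lambda>i. int i - int n" "\<lambda>k. nat (k + int n)"]) auto
  also have "\<dots> = 0"
    using choose_alternating_sum[of "2 * n", where 'a = real] False by simp
  finally show ?thesis
    using False by simp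
qed (simp add: w_def)

text \<open>The quantity of the theorem after cancelling all \<open>fact (2 * n i)\<close>, with
  indices shifted to start at 0. The last factorial also reads \<open>v m\<close>, the entry in the
  place of the final zero.\<close>

definition alt_sum :: "nat \<Rightarrow> (nat \<Rightarrow> nat) \<Rightarrow> real" where
  "alt_sum m v = fact (v 0) * (\<Prod>i<m. fact (v i + v (Suc i))) *
     (\<Sum>k = - int (v 0)..int (v 0). (-1) powi k * (\<Prod>i<m. w (v i) k))"

text \<open>The factor \<open>fact (v 0 + v 1)\<close> is exactly what \<open>w_mult\<close> needs
  to merge the first two \<open>w\<close> factors. The \<open>case_nat\<close> term is the sequence
  \<open>s\<close>, \<open>v 2\<close>, \<open>v 3\<close>, and so on.\<close>

lemma alt_sum_merge:
  "alt_sum (Suc (Suc m)) v =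
    (\<Sum>s\<le>min (v 0) (v 1). real (v 0 choose s) * real (v 1 + v 2 choose (v 1 - s)) *
       alt_sum (Suc m) (case_nat s (\<lambda>i. v (i + 2))))"
proof -
  define P where "P k = (\<Prod>i<m. w (v (i + 2)) k)" for k
  define F :: real where "F = (\<Prod>i<m. fact (v (i + 2) + v (i + 3)))"
  define K where "K = {- int (v 0)..int (v 0)}"
  define D where "D s = (\<Sum>k\<in>K. (-1) powi k * (w s k * P k))" for s
  have "alt_sum (Suc (Suc m)) v = fact (v 0) * (fact (v 1 + v 2) * F) *
      (\<Sum>k\<in>K. (-1) powi k * ((fact (v 0 + v 1) * w (v 0) k * w (v 1) k) * P k))"
    unfolding alt_sum_def
    by (simp add: prod.lessThan_Suc_shift P_def F_def K_def sum_distrib_left mult_ac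
        numeral_2_eq_2 numeral_3_eq_3 del: prod.lessThan_Suc)
  also have "(\<Sum>k\<in>K. (-1) powi k * ((fact (v 0 + v 1) * w (v 0) k * w (v 1) k) * P k)) =
      (\<Sum>k\<in>K. \<Sum>s\<le>min (v 0) (v 1). (-1) powi k * (w s k * P k) / (fact (v 0 - s) * fact (v 1 - s)))"
    unfolding w_mult by (simp add: sum_distrib_left sum_distrib_right)
  also have "\<dots> = (\<Sum>s\<le>min (v 0) (v 1). D s / (fact (v 0 - s) * fact (v 1 - s)))"
    by (subst sum.swap) (simp add: D_def sum_divide_distrib)
  also have "fact (v 0) * (fact (v 1 + v 2) * F) * \<dots> =
      (\<Sum>s\<le>min (v 0) (v 1). real (v 0 choose s) * real (v 1 + v 2 choose (v 1 - s)) *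
         (fact s * (fact (s + v 2) * F) * D s))"
    unfolding sum_distrib_left
  proof (rule sum.cong[OF refl])
    fix s assume s: "s \<in> {..min (v 0) (v 1)}"
    \<comment> \<open>The denominators \<open>fact s\<close> and \<open>fact (s + v 2)\<close> of
      the two binomials supply the leading factorials of the merged \<open>alt_sum\<close>.\<close>
    have "real (v 0 choose s) = fact (v 0) / (fact s * fact (v 0 - s))"
      using s by (subst binomial_fact) auto
    moreover have "v 1 + v 2 - (v 1 - s) = s + v 2"
      using s by auto
    then have "real (v 1 + v 2 choose (v 1 - s)) =
        fact (v 1 + v 2) / (fact (v 1 - s) * fact (s + v 2))"
      using s by (subst binomial_fact) (auto simp: add.commute)
    ultimately show "fact (v 0) * (fact (v 1 + v 2) * F) * (D s / (fact (v 0 - s) * fact (v 1 - s))) =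
        real (v 0 choose s) * real (v 1 + v 2 choose (v 1 - s)) *
          (fact s * (fact (s + v 2) * F) * D s)"
      by (simp add: field_simps)
  qed
  also have "\<dots> = (\<Sum>s\<le>min (v 0) (v 1). real (v 0 choose s) * real (v 1 + v 2 choose (v 1 - s)) *
       alt_sum (Suc m) (case_nat s (\<lambda>i. v (i + 2))))"
  proof (rule sum.cong[OF refl])
    fix s assume s: "s \<in> {..min (v 0) (v 1)}"
    \<comment> \<open>Since \<open>s \<le> v 0\<close> and \<open>w s k = 0\<close> for
      \<open>\<bar>k\<bar> > s\<close>, the range shrinks to the one the merged sequence
      prescribes.\<close>
    have "D s = (\<Sum>k = - int s..int s. (-1) powi k * (w s k * P k))"
      unfolding D_def K_def by (rule sum.mono_neutral_right) (use s in \<open>auto simp: w_def\<close>)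
    then have "alt_sum (Suc m) (case_nat s (\<lambda>i. v (i + 2))) = fact s * (fact (s + v 2) * F) * D s"
      unfolding alt_sum_def
      by (simp add: prod.lessThan_Suc_shift P_def F_def numeral_2_eq_2 numeral_3_eq_3 add.commute
          del: prod.lessThan_Suc)
    then show "real (v 0 choose s) * real (v 1 + v 2 choose (v 1 - s)) *
          (fact s * (fact (s + v 2) * F) * D s) =
        real (v 0 choose s) * real (v 1 + v 2 choose (v 1 - s)) *
          alt_sum (Suc m) (case_nat s (\<lambda>i. v (i + 2)))"
      by simp
  qed
  finally show ?thesis .
qed

lemma sum_in_Nats: "(\<And>x. x \<in> A \<Longrightarrow> f x \<in> \<nat>) \<Longrightarrow> sum f A \<in> \<nat>"
  by (induction A rule: infinite_finite_induct) auto

lemma alt_sum_Nats: "v (Suc m) = 0 \<Longrightarrow> alt_sum (Suc m) v \<in> \<nat>"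
proof (induction m arbitrary: v)
  case 0
  then show ?case
    by (simp add: alt_sum_def alternating_sum_w)
next
  case (Suc m)
  \<comment> \<open>Merging shifts later entries down by one index, so the final zero
    \<open>v (m + 2)\<close> lands at index \<open>Suc m\<close>, as the induction hypothesis
    requires.\<close>
  have "alt_sum (Suc m) (case_nat s (\<lambda>i. v (i + 2))) \<in> \<nat>" for s
    using Suc.prems by (intro Suc.IH) simp
  then show ?case
    unfolding alt_sum_merge by (intro sum_in_Nats Nats_mult of_nat_in_Nats)
qed

theorem theorem4p8:
  fixes m :: nat and n :: "nat \<Rightarrow> nat"
  assumes "m \<ge> 1"
    and "\<And>i. i \<in> {1..m} \<Longrightarrow> n i > 0"
    and "n (m + 1) = 0"
  shows "fact (n 1) * (\<Prod>i=1..m. fact (n i + n (i + 1)) / fact (2 * n i)) *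
      (\<Sum>k = - int (n 1)..int (n 1).
         (-1) powi k * (\<Prod>i=1..m. real (binom (2 * n i) (int (n i) + k)))) \<in> (\<nat> :: real set)"
proof -
  define v where "v i = n (Suc i)" for i
  \<comment> \<open>\<open>Q\<close> appears once from the central binomials and once in the
    denominator, and cancels.\<close>
  define Q :: real where "Q = (\<Prod>i<m. fact (2 * v i))"
  have shift: "(\<Prod>i=1..m. f i) = (\<Prod>i<m. f (Suc i))" for f :: "nat \<Rightarrow> real"
    by (rule prod.reindex_bij_witness[of _ Suc "\<lambda>i. i - 1"]) auto
  have "(\<Prod>i=1..m. real (binom (2 * n i) (int (n i) + k))) = Q * (\<Prod>i<m. w (v i) k)" for k
    by (simp only: shift binom_central prod.distrib Q_def v_def)
  moreover have "(\<Prod>i=1..m. fact (n i + n (i + 1)) / fact (2 * n i)) =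
      (\<Prod>i<m. fact (v i + v (Suc i))) / Q"
    unfolding shift by (simp add: prod_dividef Q_def v_def)
  moreover have "Q \<noteq> 0"
    by (simp add: Q_def)
  moreover have "(\<Sum>k\<in>A. (-1) powi k * (Q * R k)) = Q * (\<Sum>k\<in>A. (-1) powi k * R k)"
    for A :: "int set" and R :: "int \<Rightarrow> real"
    by (simp add: sum_distrib_left mult_ac)
  ultimately have "fact (n 1) * (\<Prod>i=1..m. fact (n i + n (i + 1)) / fact (2 * n i)) *
      (\<Sum>k = - int (n 1)..int (n 1).
         (-1) powi k * (\<Prod>i=1..m. real (binom (2 * n i) (int (n i) + k)))) = alt_sum m v"
    by (simp add: alt_sum_def v_def)
  moreover have "alt_sum m v \<in> \<nat>"
    using alt_sum_Nats[of v "m - 1"] assms(1,3) by (simp add: v_def)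
  ultimately show ?thesis
    by simp
qed

end
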